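(* Let $p\in\{1,2\}$, let $s\ge 1$ be an integer ($s\ge 2$ if $p=2$), let $\varepsilon\ge0$, and let the coefficients $\omega_0,\omega_1,b_j,\mu_j,\gamma_j,c_j$ and $\beta^p(s,\varepsilon)$ be as in the context. Let $A\in\mathbb{R}^{n\times n}$ be symmetric and negative semidefinite with spectral radius $\rho$, and let $\Delta t>0$ satisfy $\Delta t\rho\le\beta^p(s,\varepsilon)$. Let $\bm{r}_1,\dots,\bm{r}_s\in\mathbb{R}^n$ and for $k=1,\dots,s$ define $$\bm{d}_k=\sum_{j=1}^k\frac{b_k}{b_j}U_{k-j}(\omega_0I+\omega_1\Delta tA)(\mu_j+\gamma_j)\bm{r}_j,\qquad \tilde{\bm{d}}_k=\sum_{j=1}^k\frac{b_k}{b_j}U_{k-j}(\omega_0I+\omega_1\Delta tA)\mu_j\bm{r}_j.$$ Then: (i) $\|\bm{d}_k\|_2\le c_k\max_{j=1,\dots,k}\|\bm{r}_j\|_2$; (ii) $\|\tilde{\bm{d}}_k\|_2\le C_k\max_{j=1,\dots,k}\|\bm{r}_j\|_2$, where $C_k=c_k$ if $p=1$, and if $p=2$, $C_k$ is a constant independent of $A$, $\Delta t$ and the $\bm{r}_j$ (the paper describes it as a small constant).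
   Context: Chebyshev polynomials: $T_0(x)=1$, $T_1(x)=x$, $T_j=2xT_{j-1}-T_{j-2}$; $U_0(x)=1$, $U_1(x)=2x$, $U_j=2xU_{j-1}-U_{j-2}$. RKC coefficients: $\omega_0=1+\varepsilon/s^2$. If $p=1$: $\omega_1=T_s(\omega_0)/T_s'(\omega_0)$, $b_j=1/T_j(\omega_0)$, $j=0,\dots,s$. If $p=2$: $\omega_1=T_s'(\omega_0)/T_s''(\omega_0)$, $b_j=T_j''(\omega_0)/T_j'(\omega_0)^2$ for $j=2,\dots,s$, $b_0=b_1=b_2$. Then $a_j=1-b_jT_j(\omega_0)$; $\mu_1=b_1\omega_1$, $\gamma_1=0$; for $j\ge2$: $\mu_j=2\omega_1b_j/b_{j-1}$, $\nu_j=2\omega_0b_j/b_{j-1}$, $\kappa_j=-b_j/b_{j-2}$, $\gamma_j=-\mu_ja_{j-1}$. $c_0=0$, $c_1=\mu_1$, $c_j=\nu_jc_{j-1}+\kappa_jc_{j-2}+\mu_j+\gamma_j$. Stability bounds: $\beta^1(s,\varepsilon)=(2-\tfrac43\varepsilon)s^2$, $\beta^2(s,\varepsilon)=\tfrac23(1-\tfrac{2}{15}\varepsilon)(s^2-1)$. *)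

theory Defs
  imports "HOL-Analysis.Analysis"
begin

fun cheb_T :: "nat \<Rightarrow> real \<Rightarrow> real" where
  "cheb_T 0 x = 1"
| "cheb_T (Suc 0) x = x"
| "cheb_T (Suc (Suc j)) x = 2 * x * cheb_T (Suc j) x - cheb_T j x"

fun cheb_U :: "nat \<Rightarrow> real \<Rightarrow> real" where
  "cheb_U 0 x = 1"
| "cheb_U (Suc 0) x = 2 * x"
| "cheb_U (Suc (Suc j)) x = 2 * x * cheb_U (Suc j) x - cheb_U j x"

fun cheb_U_mat :: "nat \<Rightarrow> real^'n^'n \<Rightarrow> real^'n^'n" where
  "cheb_U_mat 0 M = mat 1"
| "cheb_U_mat (Suc 0) M = 2 *\<^sub>R M"
| "cheb_U_mat (Suc (Suc j)) M = 2 *\<^sub>R (M ** cheb_U_mat (Suc j) M) - cheb_U_mat j M"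

definition cheb_T' :: "nat \<Rightarrow> real \<Rightarrow> real" where
  "cheb_T' j x = deriv (cheb_T j) x"

definition cheb_T'' :: "nat \<Rightarrow> real \<Rightarrow> real" where
  "cheb_T'' j x = deriv (deriv (cheb_T j)) x"

definition rkc_omega0 :: "nat \<Rightarrow> real \<Rightarrow> real" where
  "rkc_omega0 s eps = 1 + eps / (real s)^2"

definition rkc_omega1 :: "nat \<Rightarrow> nat \<Rightarrow> real \<Rightarrow> real" where
  "rkc_omega1 p s eps =
     (if p = 1 then cheb_T s (rkc_omega0 s eps) / cheb_T' s (rkc_omega0 s eps)
      else cheb_T' s (rkc_omega0 s eps) / cheb_T'' s (rkc_omega0 s eps))"

definition rkc_b :: "nat \<Rightarrow> nat \<Rightarrow> real \<Rightarrow> nat \<Rightarrow> real" where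
  "rkc_b p s eps j =
     (if p = 1 then 1 / cheb_T j (rkc_omega0 s eps)
      else (let i = max j 2 in
              cheb_T'' i (rkc_omega0 s eps) / (cheb_T' i (rkc_omega0 s eps))^2))"

definition rkc_a :: "nat \<Rightarrow> nat \<Rightarrow> real \<Rightarrow> nat \<Rightarrow> real" where
  "rkc_a p s eps j = 1 - rkc_b p s eps j * cheb_T j (rkc_omega0 s eps)"

text \<open>mu_j, defined for j \<ge> 1 (value at j = 0 is irrelevant and set to 0).\<close>
definition rkc_mu :: "nat \<Rightarrow> nat \<Rightarrow> real \<Rightarrow> nat \<Rightarrow> real" where
  "rkc_mu p s eps j =
     (if j = 0 then 0
      else if j = 1 then rkc_b p s eps 1 * rkc_omega1 p s eps
      else 2 * rkc_omega1 p s eps * rkc_b p s eps j / rkc_b p s eps (j - 1))"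

definition rkc_nu :: "nat \<Rightarrow> nat \<Rightarrow> real \<Rightarrow> nat \<Rightarrow> real" where
  "rkc_nu p s eps j = 2 * rkc_omega0 s eps * rkc_b p s eps j / rkc_b p s eps (j - 1)"

definition rkc_kappa :: "nat \<Rightarrow> nat \<Rightarrow> real \<Rightarrow> nat \<Rightarrow> real" where
  "rkc_kappa p s eps j = - rkc_b p s eps j / rkc_b p s eps (j - 2)"

definition rkc_gamma :: "nat \<Rightarrow> nat \<Rightarrow> real \<Rightarrow> nat \<Rightarrow> real" where
  "rkc_gamma p s eps j =
     (if j \<le> 1 then 0 else - rkc_mu p s eps j * rkc_a p s eps (j - 1))"

fun rkc_c :: "nat \<Rightarrow> nat \<Rightarrow> real \<Rightarrow> nat \<Rightarrow> real" where
  "rkc_c p s eps 0 = 0"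
| "rkc_c p s eps (Suc 0) = rkc_mu p s eps 1"
| "rkc_c p s eps (Suc (Suc j)) =
     rkc_nu p s eps (Suc (Suc j)) * rkc_c p s eps (Suc j)
     + rkc_kappa p s eps (Suc (Suc j)) * rkc_c p s eps j
     + rkc_mu p s eps (Suc (Suc j)) + rkc_gamma p s eps (Suc (Suc j))"

definition rkc_beta :: "nat \<Rightarrow> nat \<Rightarrow> real \<Rightarrow> real" where
  "rkc_beta p s eps =
     (if p = 1 then (2 - 4/3 * eps) * (real s)^2
      else 2/3 * (1 - 2/15 * eps) * ((real s)^2 - 1))"

definition complexify_mat :: "real^'n^'n \<Rightarrow> complex^'n^'n" where
  "complexify_mat A = (\<chi> i j. complex_of_real (A $ i $ j))"

definition spec_radius :: "real^'n^'n \<Rightarrow> real" where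
  "spec_radius A = Sup {cmod z | z. \<exists>v :: complex^'n. v \<noteq> 0 \<and> complexify_mat A *v v = z *s v}"

definition rkc_M :: "nat \<Rightarrow> nat \<Rightarrow> real \<Rightarrow> real \<Rightarrow> real^'n^'n \<Rightarrow> real^'n^'n" where
  "rkc_M p s eps dt A = rkc_omega0 s eps *\<^sub>R mat 1 + (rkc_omega1 p s eps * dt) *\<^sub>R A"

definition rkc_d :: "nat \<Rightarrow> nat \<Rightarrow> real \<Rightarrow> real \<Rightarrow> real^'n^'n \<Rightarrow> (nat \<Rightarrow> real^'n) \<Rightarrow> nat \<Rightarrow> real^'n" where
  "rkc_d p s eps dt A r k =
     (\<Sum>j = 1..k. (rkc_b p s eps k / rkc_b p s eps j * (rkc_mu p s eps j + rkc_gamma p s eps j))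
        *\<^sub>R (cheb_U_mat (k - j) (rkc_M p s eps dt A) *v r j))"

definition rkc_dtilde :: "nat \<Rightarrow> nat \<Rightarrow> real \<Rightarrow> real \<Rightarrow> real^'n^'n \<Rightarrow> (nat \<Rightarrow> real^'n) \<Rightarrow> nat \<Rightarrow> real^'n" where
  "rkc_dtilde p s eps dt A r k =
     (\<Sum>j = 1..k. (rkc_b p s eps k / rkc_b p s eps j * rkc_mu p s eps j)
        *\<^sub>R (cheb_U_mat (k - j) (rkc_M p s eps dt A) *v r j))"

end

theory Submission
  imports Defs "HOL-Computational_Algebra.Polynomial"
begin

text \<open>Both vectors are sums of terms \<open>U\<^sub>k\<^sub>-\<^sub>j(M) r\<^sub>j\<close> with the symmetric matrix
  \<open>M = \<omega>\<^sub>0 I + \<omega>\<^sub>1 \<Delta>t A\<close>. The condition \<open>\<Delta>t \<rho> \<le> \<beta>\<close> confines the spectrum of \<open>M\<close> to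
  \<open>[-\<omega>\<^sub>0, \<omega>\<^sub>0]\<close>, so expanding in an orthonormal eigenbasis of \<open>A\<close> and using
  \<open>|U\<^sub>m(x)| \<le> U\<^sub>m(y)\<close> for \<open>|x| \<le> y\<close>, \<open>1 \<le> y\<close> gives \<open>\<parallel>U\<^sub>m(M)\<parallel> \<le> U\<^sub>m(\<omega>\<^sub>0)\<close>.
  The triangle inequality then bounds \<open>\<parallel>d\<^sub>k\<parallel>\<close> by
  \<open>\<Sum>\<^sub>j (b\<^sub>k/b\<^sub>j)(\<mu>\<^sub>j+\<gamma>\<^sub>j) U\<^sub>k\<^sub>-\<^sub>j(\<omega>\<^sub>0) max \<parallel>r\<^sub>j\<parallel>\<close>, and this sum is \<open>c\<^sub>k\<close>
  because it satisfies the three-term recurrence defining \<open>c\<^sub>k\<close>.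

  The spectral inclusion amounts to \<open>\<omega>\<^sub>1 \<beta> \<le> 2\<omega>\<^sub>0\<close>, a polynomial inequality in
  \<open>d = \<omega>\<^sub>0 - 1 \<ge> 0\<close> between \<open>T\<^sub>s, T\<^sub>s', T\<^sub>s''\<close>. It holds coefficientwise: by Chebyshev's
  differential equation the Taylor coefficients \<open>q\<^sub>k\<close> of \<open>T\<^sub>s(1 + d)\<close> satisfy
  \<open>(k+1)(2k+1) q\<^sub>k\<^sub>+\<^sub>1 = (s\<^sup>2 - k\<^sup>2) q\<^sub>k\<close>, so they are nonnegative and each coefficient of the
  difference is a nonnegative multiple of a single \<open>q\<^sub>k\<close>.
  For \<open>p = 1\<close> all \<open>\<gamma>\<^sub>j\<close> vanish, so \<open>d\<^sub>k\<close> and its tilde version coincide; for \<open>p = 2\<close> the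
  same estimate gives \<open>C\<^sub>k = \<Sum>\<^sub>j (b\<^sub>k/b\<^sub>j) \<mu>\<^sub>j U\<^sub>k\<^sub>-\<^sub>j(\<omega>\<^sub>0)\<close>.\<close>

section \<open>Taylor coefficients of \<open>T\<^sub>n\<close> at 1\<close>

fun shifted_cheb_T :: "nat \<Rightarrow> real poly" where
  "shifted_cheb_T 0 = 1"
| "shifted_cheb_T (Suc 0) = [:1, 1:]"
| "shifted_cheb_T (Suc (Suc n)) = 2 * [:1, 1:] * shifted_cheb_T (Suc n) - shifted_cheb_T n"

lemma poly_shifted_cheb_T: "poly (shifted_cheb_T n) d = cheb_T n (1 + d)"
  by (induction n rule: induct_nat_012) (auto simp: algebra_simps)

lemma pderiv_two_x_mult:
  "pderiv (2 * [:1, 1:] * p) = 2 * p + 2 * [:1, 1:] * pderiv (p :: real poly)"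
  by (simp only: pderiv_mult pderiv_numeral pderiv_pCons) (simp add: algebra_simps)

lemma pderiv_shifted_cheb_T_Suc_Suc:
  "pderiv (shifted_cheb_T (Suc (Suc n))) =
     2 * shifted_cheb_T (Suc n) + 2 * [:1, 1:] * pderiv (shifted_cheb_T (Suc n))
     - pderiv (shifted_cheb_T n)"
  by (simp only: shifted_cheb_T.simps(3) pderiv_diff pderiv_two_x_mult)

lemma shifted_cheb_T_deriv_eq:
  "[:0, 2, 1:] * pderiv (shifted_cheb_T (Suc n))
     = of_nat (Suc n) * ([:1, 1:] * shifted_cheb_T (Suc n) - shifted_cheb_T n)"
proof (induction n rule: induct_nat_012)
  case 0
  show ?case by (simp add: pderiv_pCons) (subst one_pCons, simp)
next
  case 1
  show ?case by (simp add: numeral_poly one_pCons pderiv_pCons of_nat_poly)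
next
  case (ge2 n)
  define x :: "real poly" where "x = [:1, 1:]"
  have "[:0, 2, 1:] = x * x - 1"
    by (simp add: x_def) (subst one_pCons, simp)
  moreover have "shifted_cheb_T n = 2 * x * shifted_cheb_T (Suc n) - shifted_cheb_T (Suc (Suc n))"
    by (simp add: x_def)
  moreover note pderiv_shifted_cheb_T_Suc_Suc[of "Suc n", folded x_def]
    shifted_cheb_T.simps(3)[of "Suc n", folded x_def] ge2[folded x_def]
  ultimately show ?case
    unfolding x_def[symmetric] by (simp only: of_nat_Suc) algebra
qed

text \<open>The Chebyshev differential equation \<open>(x\<^sup>2 - 1) T'' + x T' = n\<^sup>2 T\<close>, written in \<open>d = x - 1\<close>.\<close>
lemma shifted_cheb_T_ode:
  "[:0, 2, 1:] * pderiv (pderiv (shifted_cheb_T n)) + [:1, 1:] * pderiv (shifted_cheb_T n)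
     = of_nat n ^ 2 * shifted_cheb_T n"
proof (induction n rule: induct_nat_012)
  case 0
  show ?case by simp
next
  case 1
  show ?case by (simp add: pderiv_pCons)
next
  case (ge2 n)
  define x :: "real poly" where "x = [:1, 1:]"
  have "pderiv (pderiv (shifted_cheb_T (Suc (Suc n)))) =
      4 * pderiv (shifted_cheb_T (Suc n)) + 2 * x * pderiv (pderiv (shifted_cheb_T (Suc n)))
      - pderiv (pderiv (shifted_cheb_T n))"
    unfolding pderiv_shifted_cheb_T_Suc_Suc x_def
    by (simp only: pderiv_add pderiv_diff pderiv_mult pderiv_numeral pderiv_two_x_mult)
      (simp add: pderiv_pCons algebra_simps del: shifted_cheb_T.simps)
  with pderiv_shifted_cheb_T_Suc_Suc[of n, folded x_def] shifted_cheb_T.simps(3)[of n, folded x_def]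
    shifted_cheb_T_deriv_eq[of n, folded x_def] ge2[folded x_def]
  show ?case
    unfolding x_def[symmetric] by (simp only: of_nat_Suc) algebra
qed

lemma coeff_shifted_cheb_T_Suc:
  "real (Suc k) * (2 * real k + 1) * coeff (shifted_cheb_T n) (Suc k)
     = ((real n)^2 - (real k)^2) * coeff (shifted_cheb_T n) k"
proof -
  have "coeff ([:0, 2, 1:] * pderiv (pderiv (shifted_cheb_T n))
      + [:1, 1:] * pderiv (shifted_cheb_T n)) k = (real n)^2 * coeff (shifted_cheb_T n) k"
    unfolding shifted_cheb_T_ode by (simp add: of_nat_poly power2_eq_square)
  then show ?thesis
    by (cases k)
      (auto simp: coeff_pderiv coeff_pCons algebra_simps power2_eq_square split: nat.splits)
qed

lemma coeff_shifted_cheb_T_0: "coeff (shifted_cheb_T n) 0 = 1"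
proof -
  have "poly (shifted_cheb_T n) 0 = 1"
    by (induction n rule: induct_nat_012) simp_all
  then show ?thesis by (simp add: poly_0_coeff_0)
qed

lemma coeff_shifted_cheb_T_nonneg: "0 \<le> coeff (shifted_cheb_T n) k"
  and coeff_shifted_cheb_T_eq_0: "n < k \<Longrightarrow> coeff (shifted_cheb_T n) k = 0"
proof -
  have "0 \<le> coeff (shifted_cheb_T n) k \<and> (n < k \<longrightarrow> coeff (shifted_cheb_T n) k = 0)"
  proof (induction k)
    case 0
    then show ?case by (simp add: coeff_shifted_cheb_T_0)
  next
    case (Suc k)
    have pos: "real (Suc k) * (2 * real k + 1) > 0" by simp
    show ?case
    proof (cases "k < n")
      case True
      then have "0 \<le> ((real n)^2 - (real k)^2) * coeff (shifted_cheb_T n) k"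
        using Suc.IH by (simp add: power_mono)
      then have "0 \<le> real (Suc k) * (2 * real k + 1) * coeff (shifted_cheb_T n) (Suc k)"
        by (simp only: coeff_shifted_cheb_T_Suc)
      then have "0 \<le> coeff (shifted_cheb_T n) (Suc k)"
        using pos by (metis zero_le_mult_iff not_le)
      then show ?thesis
        using True by simp
    next
      case False
      then have "((real n)^2 - (real k)^2) * coeff (shifted_cheb_T n) k = 0"
        using Suc.IH by (cases "k = n") auto
      then have "coeff (shifted_cheb_T n) (Suc k) = 0"
        using pos by (simp flip: coeff_shifted_cheb_T_Suc)
      then show ?thesis by simp
    qed
  qed
  then show "0 \<le> coeff (shifted_cheb_T n) k" and "n < k \<Longrightarrow> coeff (shifted_cheb_T n) k = 0"
    by auto
qed

lemma coeff_shifted_cheb_T_1: "coeff (shifted_cheb_T n) 1 = (real n)^2"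
  using coeff_shifted_cheb_T_Suc[of 0 n] by (simp add: coeff_shifted_cheb_T_0)

lemma coeff_shifted_cheb_T_2: "6 * coeff (shifted_cheb_T n) 2 = ((real n)^2 - 1) * (real n)^2"
  using coeff_shifted_cheb_T_Suc[of 1 n] coeff_shifted_cheb_T_1[of n] by (simp add: numeral_2_eq_2)

lemma coeff_0_le_poly:
  fixes p :: "real poly"
  assumes "\<And>k. 0 \<le> coeff p k" and "0 \<le> d"
  shows "coeff p 0 \<le> poly p d"
proof -
  have "coeff p 0 * d ^ 0 \<le> (\<Sum>i\<le>degree p. coeff p i * d ^ i)"
    by (rule member_le_sum) (use assms in auto)
  then show ?thesis by (simp add: poly_altdef)
qed

lemma deriv_poly_shift: "deriv (\<lambda>x. poly p (x - 1)) = (\<lambda>x. poly (pderiv p) (x - 1 :: real))"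
proof
  fix x :: real
  have "((\<lambda>x. poly p (x - 1)) has_real_derivative poly (pderiv p) (x - 1)) (at x)"
    using DERIV_chain2[OF poly_DERIV, of "\<lambda>x. x - 1"] by (auto intro!: derivative_eq_intros)
  then show "deriv (\<lambda>x. poly p (x - 1)) x = poly (pderiv p) (x - 1)"
    by (rule DERIV_imp_deriv)
qed

lemma cheb_T_eq_poly: "cheb_T n = (\<lambda>x. poly (shifted_cheb_T n) (x - 1))"
  by (simp add: poly_shifted_cheb_T)

lemma cheb_T'_eq_poly: "cheb_T' n x = poly (pderiv (shifted_cheb_T n)) (x - 1)"
  unfolding cheb_T'_def cheb_T_eq_poly deriv_poly_shift ..

lemma cheb_T''_eq_poly: "cheb_T'' n x = poly (pderiv (pderiv (shifted_cheb_T n))) (x - 1)"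
  unfolding cheb_T''_def cheb_T_eq_poly deriv_poly_shift ..

lemma cheb_T_ge_1: "0 \<le> d \<Longrightarrow> 1 \<le> cheb_T n (1 + d)"
  using coeff_0_le_poly[of "shifted_cheb_T n" d]
  by (simp add: coeff_shifted_cheb_T_nonneg coeff_shifted_cheb_T_0 poly_shifted_cheb_T)

lemma cheb_T'_ge: "0 \<le> d \<Longrightarrow> (real n)^2 \<le> cheb_T' n (1 + d)"
  using coeff_0_le_poly[of "pderiv (shifted_cheb_T n)" d] coeff_shifted_cheb_T_1[of n]
  by (simp add: cheb_T'_eq_poly coeff_pderiv coeff_shifted_cheb_T_nonneg)

lemma cheb_T''_ge: "0 \<le> d \<Longrightarrow> ((real n)^2 - 1) * (real n)^2 / 3 \<le> cheb_T'' n (1 + d)"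
  using coeff_0_le_poly[of "pderiv (pderiv (shifted_cheb_T n))" d] coeff_shifted_cheb_T_2[of n]
  by (simp add: cheb_T''_eq_poly coeff_pderiv coeff_shifted_cheb_T_nonneg numeral_2_eq_2)

text \<open>The value at \<open>d\<close> is \<open>2(1 + d) T\<^sub>n'(1 + d) - \<beta> T\<^sub>n(1 + d)\<close>, where
  \<open>\<beta> = 2n\<^sup>2 - (4/3) n\<^sup>4 d\<close> is \<open>\<beta>\<^sup>1(n, \<epsilon>)\<close> for \<open>\<epsilon> = n\<^sup>2 d\<close>.\<close>
definition rkc1_bound_poly :: "nat \<Rightarrow> real poly" where
  "rkc1_bound_poly n = smult 2 ([:1, 1:] * pderiv (shifted_cheb_T n))
    - smult (2 * (real n)^2) (shifted_cheb_T n)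
    + smult (4/3 * (real n)^4) ([:0, 1:] * shifted_cheb_T n)"

text \<open>\<open>A, B, C\<close> stand for the Taylor coefficients \<open>q\<^sub>j, q\<^sub>j\<^sub>+\<^sub>1, q\<^sub>j\<^sub>+\<^sub>2\<close> of
  \<open>T\<^sub>n(1 + d)\<close>; the right-hand side is the coefficient of \<open>d\<^sup>j\<^sup>+\<^sup>1\<close> in \<open>rkc1_bound_poly n\<close>.\<close>
lemma rkc1_bound_coeff_ineq:
  fixes n j A B C :: real
  assumes "0 \<le> A" "0 \<le> j" "0 \<le> n"
    and rec1: "(j+1)*(2*j+1)*B = (n^2-j^2)*A" and rec2: "(j+2)*(2*j+3)*C = (n^2-(j+1)^2)*B"
    and "j \<le> n \<or> A = 0"
  shows "0 \<le> 2*(j+2)*C + 2*(j+1)*B - 2*n^2*B + 4/3*n^4*A"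
proof -
  let ?X = "2*(j+2)*C + 2*(j+1)*B - 2*n^2*B + 4/3*n^4*A"
  let ?R = "4/3*(2*j+3)*n^4*A - (2*j+2)*(2*n^2-j-2)*B"
  let ?P = "4/3*(2*j+1)*(2*j+3)*n^4 - 2*((2*n^2-j-2)*(n^2-j^2))"
  have "(2*j+3)*?X - ?R = 2*((j+2)*(2*j+3)*C - (n^2-(j+1)^2)*B)"
    by (simp add: algebra_simps power2_eq_square)
  then have X: "(2*j+3)*?X = ?R" using rec2 by simp
  have "(2*j+1)*?R - A*?P = - 2*(2*n^2-j-2)*((j+1)*(2*j+1)*B - (n^2-j^2)*A)"
    by (simp add: algebra_simps power2_eq_square)
  then have XP: "(2*j+1)*((2*j+3)*?X) = A*?P" unfolding X using rec1 by simp
  have "0 \<le> ?P" if "j \<le> n"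
  proof -
    have P: "0 \<le> n^2 - j^2" "n^2 - j^2 \<le> n^2" using that assms(2,3) by (auto simp: power_mono)
    have "(2*n^2-j-2)*(n^2-j^2) \<le> (2*n^2)*n^2"
    proof (cases "0 \<le> 2*n^2-j-2")
      case True
      then show ?thesis using P assms(2) by (intro mult_mono) auto
    next
      case False
      then show ?thesis using P by (smt (verit) mult_nonpos_nonneg zero_le_mult_iff zero_le_power2)
    qed
    also have "(2*n^2)*n^2 = 2*n^4"
      by (simp add: power2_eq_square power4_eq_xxxx)
    finally have "(2*n^2-j-2)*(n^2-j^2) \<le> 2*n^4" .
    moreover have "4*n^4 \<le> 4/3*(2*j+1)*(2*j+3)*n^4"
      using assms(2) by (intro mult_right_mono) (auto simp: algebra_simps)
    ultimately show ?thesis by linarith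
  qed
  then have "0 \<le> (2*j+1)*((2*j+3)*?X)" unfolding XP using assms(1,6) by auto
  then show ?thesis using assms(2) by (simp add: zero_le_mult_iff)
qed

lemma coeff_rkc1_bound_poly_nonneg: "0 \<le> coeff (rkc1_bound_poly n) k"
proof (cases k)
  case 0
  then show ?thesis
    using coeff_shifted_cheb_T_1[of n]
    by (simp add: rkc1_bound_poly_def coeff_pderiv coeff_shifted_cheb_T_0)
next
  case (Suc j)
  let ?q = "coeff (shifted_cheb_T n)"
  have "0 \<le> 2*(real j+2)*?q (Suc (Suc j)) + 2*(real j+1)*?q (Suc j)
      - 2*(real n)^2*?q (Suc j) + 4/3*(real n)^4*?q j"
  proof (rule rkc1_bound_coeff_ineq)
    show "(real j+1)*(2*real j+1)*?q (Suc j) = ((real n)^2-(real j)^2)*?q j"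
      using coeff_shifted_cheb_T_Suc[of j n] by (simp add: algebra_simps)
    show "(real j+2)*(2*real j+3)*?q (Suc (Suc j)) = ((real n)^2-(real j+1)^2)*?q (Suc j)"
      using coeff_shifted_cheb_T_Suc[of "Suc j" n] by (simp add: algebra_simps)
    show "real j \<le> real n \<or> ?q j = 0"
      using coeff_shifted_cheb_T_eq_0[of n j] by linarith
  qed (simp_all add: coeff_shifted_cheb_T_nonneg)
  then show ?thesis using Suc by (simp add: rkc1_bound_poly_def coeff_pderiv algebra_simps)
qed

lemma cheb_T_rkc1_bound:
  assumes "0 \<le> d"
  shows "(2 * (real n)^2 - 4/3 * (real n)^4 * d) * cheb_T n (1 + d)
    \<le> 2 * (1 + d) * cheb_T' n (1 + d)"
proof -
  have "0 \<le> poly (rkc1_bound_poly n) d"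
    using coeff_0_le_poly[OF coeff_rkc1_bound_poly_nonneg assms] coeff_rkc1_bound_poly_nonneg
    by (meson order_trans)
  then show ?thesis
    by (simp add: rkc1_bound_poly_def cheb_T'_eq_poly poly_shifted_cheb_T algebra_simps)
qed

text \<open>The value at \<open>d\<close> is \<open>2(1 + d) T\<^sub>n''(1 + d) - \<beta> T\<^sub>n'(1 + d)\<close>, where
  \<open>\<beta> = (2/3)(n\<^sup>2 - 1) - (4/45) n\<^sup>2 (n\<^sup>2 - 1) d\<close> is \<open>\<beta>\<^sup>2(n, \<epsilon>)\<close> for \<open>\<epsilon> = n\<^sup>2 d\<close>.\<close>
definition rkc2_bound_poly :: "nat \<Rightarrow> real poly" where
  "rkc2_bound_poly n = smult 2 ([:1, 1:] * pderiv (pderiv (shifted_cheb_T n)))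
    - smult (2/3 * ((real n)^2 - 1)) (pderiv (shifted_cheb_T n))
    + smult (4/45 * (real n)^2 * ((real n)^2 - 1)) ([:0, 1:] * pderiv (shifted_cheb_T n))"

lemma rkc2_coeff_factor_nonneg:
  fixes n k :: real
  assumes "1 \<le> k" "k \<le> n" "k = 1 \<or> 2 \<le> k"
  shows "0 \<le> (n^2-k^2) * (2*(n^2-(k+1)^2) + (2*k+3)*(2*k - 2/3*(n^2-1)))
    + (2*k+1)*(2*k+3)*(4/45)*n^2*(n^2-1)*k"
    (is "0 \<le> ?P")
proof -
  let ?G = "2*(n^2-(k+1)^2) + (2*k+3)*(2*k - 2/3*(n^2-1))"
  have n1: "0 \<le> n^2 - 1" using assms(1,2) by (simp add: one_le_power)
  show ?thesis
  proof (cases "k = 1")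
    case True
    then have "?P = (n^2-1)*16/3" by algebra
    moreover have "0 \<le> (n^2-1)*16/3" using n1 by simp
    ultimately show ?thesis by (simp only:)
  next
    case False
    then have "2 \<le> k" using assms(3) by auto
    let ?W = "(2*k+3)*n^2*(n^2-1)"
    have P: "0 \<le> n^2-k^2" "n^2-k^2 \<le> n^2" using assms(1,2) by (auto simp: power_mono)
    have "?G + 2/3*(2*k+3)*(n^2-1) = 2*n^2 + 2*k^2 + 2*k - 2" by algebra
    moreover have "0 \<le> 2*n^2 + 2*k^2 + 2*k - 2"
      using assms(1) one_le_power[of k 2] zero_le_power2[of n] by linarith
    ultimately have "0 \<le> (n^2-k^2) * (?G + 2/3*(2*k+3)*(n^2-1))"
      using P by simp
    moreover have "(n^2-k^2) * ((2*k+3)*(n^2-1)) \<le> n^2 * ((2*k+3)*(n^2-1))"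
      using P n1 assms(1) by (intro mult_right_mono) auto
    moreover have "2/3 * ?W \<le> 4/45*(k*(2*k+1)) * ?W"
    proof (rule mult_right_mono)
      have "2*(2*2+1) \<le> k*(2*k+1)" using \<open>2 \<le> k\<close> by (intro mult_mono) auto
      then show "2/3 \<le> 4/45*(k*(2*k+1))" by simp
    qed (use n1 assms(1) in simp)
    moreover have "?P = (n^2-k^2) * (?G + 2/3*(2*k+3)*(n^2-1))
        - 2/3 * ((n^2-k^2) * ((2*k+3)*(n^2-1))) + 4/45*(k*(2*k+1)) * ?W"
      by algebra
    moreover have "n^2 * ((2*k+3)*(n^2-1)) = ?W" by algebra
    ultimately show ?thesis by linarith
  qed
qed

text \<open>\<open>A, B, C\<close> stand for \<open>q\<^sub>k, q\<^sub>k\<^sub>+\<^sub>1, q\<^sub>k\<^sub>+\<^sub>2\<close> as above; the right-hand side is the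
  coefficient of \<open>d\<^sup>k\<close> in \<open>rkc2_bound_poly n\<close>. The disjunction \<open>k = 1 \<or> 2 \<le> k\<close> records that
  \<open>k\<close> is a positive integer.\<close>
lemma rkc2_bound_coeff_ineq:
  fixes n k A B C :: real
  assumes "0 \<le> A" "1 \<le> k" "k = 1 \<or> 2 \<le> k"
    and rec1: "(k+1)*(2*k+1)*B = (n^2-k^2)*A" and rec2: "(k+2)*(2*k+3)*C = (n^2-(k+1)^2)*B"
    and "k \<le> n \<or> A = 0"
  shows "0 \<le> 2*(k+1)*(k+2)*C + 2*k*(k+1)*B - 2/3*(n^2-1)*(k+1)*B + 4/45*n^2*(n^2-1)*k*A"
proof -
  let ?X = "2*(k+1)*(k+2)*C + 2*k*(k+1)*B - 2/3*(n^2-1)*(k+1)*B + 4/45*n^2*(n^2-1)*k*A"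
  let ?G = "2*(n^2-(k+1)^2) + (2*k+3)*(2*k - 2/3*(n^2-1))"
  let ?R = "(k+1)*B*?G + (2*k+3)*(4/45)*n^2*(n^2-1)*k*A"
  let ?P = "(n^2-k^2)*?G + (2*k+1)*(2*k+3)*(4/45)*n^2*(n^2-1)*k"
  have "(2*k+3)*?X - ?R = 2*(k+1)*((k+2)*(2*k+3)*C - (n^2-(k+1)^2)*B)"
    by algebra
  then have X: "(2*k+3)*?X = ?R" using rec2 by simp
  have "(2*k+1)*?R - A*?P = ?G*((k+1)*(2*k+1)*B - (n^2-k^2)*A)"
    by algebra
  then have "(2*k+1)*((2*k+3)*?X) = A*?P" unfolding X using rec1 by simp
  also have "0 \<le> A*?P"
    using assms(1,6) rkc2_coeff_factor_nonneg[OF assms(2) _ assms(3)] by auto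
  finally show ?thesis using assms(2) by (simp add: zero_le_mult_iff)
qed

lemma coeff_rkc2_bound_poly_nonneg: "0 \<le> coeff (rkc2_bound_poly n) k"
proof (cases "k = 0")
  case True
  then show ?thesis
    using coeff_shifted_cheb_T_Suc[of 1 n] coeff_shifted_cheb_T_nonneg[of n 1]
    by (simp add: rkc2_bound_poly_def coeff_pderiv algebra_simps numeral_2_eq_2)
next
  case False
  let ?q = "coeff (shifted_cheb_T n)"
  have "0 \<le> 2*(real k+1)*(real k+2)*?q (Suc (Suc k)) + 2*real k*(real k+1)*?q (Suc k)
      - 2/3*((real n)^2-1)*(real k+1)*?q (Suc k) + 4/45*(real n)^2*((real n)^2-1)*real k*?q k"
  proof (rule rkc2_bound_coeff_ineq)
    show "(real k+1)*(2*real k+1)*?q (Suc k) = ((real n)^2-(real k)^2)*?q k"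
      using coeff_shifted_cheb_T_Suc[of k n] by (simp add: algebra_simps)
    show "(real k+2)*(2*real k+3)*?q (Suc (Suc k)) = ((real n)^2-(real k+1)^2)*?q (Suc k)"
      using coeff_shifted_cheb_T_Suc[of "Suc k" n] by (simp add: algebra_simps)
    show "real k \<le> real n \<or> ?q k = 0"
      using coeff_shifted_cheb_T_eq_0[of n k] by linarith
  qed (use False coeff_shifted_cheb_T_nonneg in auto)
  also have "\<dots> = coeff (rkc2_bound_poly n) k"
  proof -
    obtain j where k: "k = Suc j" using False not0_implies_Suc by blast
    show ?thesis unfolding k by (simp add: rkc2_bound_poly_def coeff_pderiv) algebra
  qed
  finally show ?thesis .
qed

lemma cheb_T_rkc2_bound:
  assumes "0 \<le> d"
  shows "(2/3 * ((real n)^2 - 1) - 4/45 * (real n)^2 * ((real n)^2 - 1) * d) * cheb_T' n (1 + d)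
    \<le> 2 * (1 + d) * cheb_T'' n (1 + d)"
proof -
  have "0 \<le> poly (rkc2_bound_poly n) d"
    using coeff_0_le_poly[OF coeff_rkc2_bound_poly_nonneg assms] coeff_rkc2_bound_poly_nonneg
    by (meson order_trans)
  then show ?thesis
    by (simp add: rkc2_bound_poly_def cheb_T'_eq_poly cheb_T''_eq_poly algebra_simps)
qed

section \<open>Chebyshev polynomials of the second kind\<close>

lemma cheb_U_one: "cheb_U m 1 = real m + 1"
  by (induction m rule: induct_nat_012) auto

lemma cheb_U_minus: "cheb_U m (- x) = (-1)^m * cheb_U m x"
  by (induction m rule: induct_nat_012) (auto simp: algebra_simps)

lemma cheb_U_cos: "cheb_U m (cos t) * sin t = sin ((real m + 1) * t)"
proof (induction m rule: induct_nat_012)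
  case 1
  then show ?case by (simp add: sin_double)
next
  case (ge2 j)
  have "sin ((real j + 3) * t) = 2 * cos t * sin ((real j + 2) * t) - sin ((real j + 1) * t)"
    using sin_add[of "(real j + 2) * t" t] sin_diff[of "(real j + 2) * t" t]
    by (simp add: algebra_simps)
  with ge2 show ?case by (simp add: algebra_simps)
qed simp

lemma abs_sin_mult_le: "\<bar>sin (real n * t)\<bar> \<le> real n * \<bar>sin t\<bar>"
proof (induction n)
  case (Suc n)
  have "\<bar>sin (real (Suc n) * t)\<bar> = \<bar>sin (real n * t) * cos t + cos (real n * t) * sin t\<bar>"
    by (simp add: distrib_right sin_add algebra_simps)
  also have "\<dots> \<le> \<bar>sin (real n * t)\<bar> * \<bar>cos t\<bar> + \<bar>cos (real n * t)\<bar> * \<bar>sin t\<bar>"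
    by (metis abs_mult abs_triangle_ineq)
  also have "\<dots> \<le> \<bar>sin (real n * t)\<bar> + \<bar>sin t\<bar>"
    by (intro add_mono mult_right_le_one_le mult_left_le_one_le) auto
  finally show ?case using Suc by (simp add: algebra_simps)
qed simp

lemma abs_cheb_U_le: "\<bar>x\<bar> \<le> 1 \<Longrightarrow> \<bar>cheb_U m x\<bar> \<le> real m + 1"
proof -
  assume "\<bar>x\<bar> \<le> 1"
  then obtain t where x: "x = cos t" using cos_arccos_abs by metis
  show ?thesis
  proof (cases "sin t = 0")
    case True
    then have "x = 1 \<or> x = -1" using x sin_cos_squared_add[of t] by (simp add: power2_eq_1_iff)
    then show ?thesis by (auto simp: cheb_U_one cheb_U_minus abs_mult)
  next
    case False
    have "\<bar>cheb_U m x\<bar> * \<bar>sin t\<bar> = \<bar>sin (real (Suc m) * t)\<bar>"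
      using cheb_U_cos[of m t] x by (simp add: add.commute flip: abs_mult)
    also have "\<dots> \<le> (real m + 1) * \<bar>sin t\<bar>"
      using abs_sin_mult_le[of "Suc m" t] by (simp add: ac_simps)
    finally show ?thesis using False by simp
  qed
qed

lemma cheb_U_nonneg_mono_step:
  assumes "1 \<le> x" shows "0 \<le> cheb_U m x \<and> cheb_U m x \<le> cheb_U (Suc m) x"
proof (induction m)
  case (Suc m)
  have "2 * cheb_U (Suc m) x \<le> 2 * x * cheb_U (Suc m) x"
    using Suc assms by (simp add: mult_right_mono)
  then show ?case using Suc by auto
qed (use assms in simp)

lemma cheb_U_nonneg: "1 \<le> x \<Longrightarrow> 0 \<le> cheb_U m x"
  using cheb_U_nonneg_mono_step by blast

lemma cheb_U_mono_step:
  assumes "1 \<le> x" "x \<le> y"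
  shows "0 \<le> cheb_U m y - cheb_U m x
    \<and> cheb_U m y - cheb_U m x \<le> cheb_U (Suc m) y - cheb_U (Suc m) x"
proof (induction m)
  case (Suc m)
  let ?D = "\<lambda>m. cheb_U m y - cheb_U m x"
  have "?D (Suc (Suc m)) = 2 * y * ?D (Suc m) + 2 * (y - x) * cheb_U (Suc m) x - ?D m"
    by (simp add: algebra_simps)
  moreover have "2 * ?D (Suc m) \<le> 2 * y * ?D (Suc m)"
    using Suc assms by (intro mult_right_mono) auto
  moreover have "0 \<le> 2 * (y - x) * cheb_U (Suc m) x"
    using cheb_U_nonneg[OF assms(1)] assms by simp
  ultimately show ?case using Suc by auto
qed (use assms in simp)

lemma cheb_U_mono: "1 \<le> x \<Longrightarrow> x \<le> y \<Longrightarrow> cheb_U m x \<le> cheb_U m y"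
  using cheb_U_mono_step by fastforce

lemma abs_cheb_U_le_cheb_U:
  assumes "\<bar>x\<bar> \<le> y" "1 \<le> y"
  shows "\<bar>cheb_U m x\<bar> \<le> cheb_U m y"
proof (cases "\<bar>x\<bar> \<le> 1")
  case True
  then have "\<bar>cheb_U m x\<bar> \<le> cheb_U m 1" by (simp add: abs_cheb_U_le cheb_U_one)
  also have "\<dots> \<le> cheb_U m y" using assms by (intro cheb_U_mono) auto
  finally show ?thesis .
next
  case False
  have "\<bar>cheb_U m x\<bar> = \<bar>cheb_U m \<bar>x\<bar>\<bar>"
    using cheb_U_minus[of m x] by (cases "0 \<le> x") (auto simp: abs_mult)
  also have "\<dots> = cheb_U m \<bar>x\<bar>"
    using False cheb_U_nonneg[of "\<bar>x\<bar>" m] by simp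
  also have "\<dots> \<le> cheb_U m y" using False assms by (intro cheb_U_mono) auto
  finally show ?thesis .
qed

section \<open>Symmetric matrices\<close>

lemma linear_coeff_eq_0_if_quadratic_nonneg:
  fixes a b :: real
  assumes "\<And>t. 0 \<le> a * t + b * t^2"
  shows "a = 0"
proof -
  define c where "c = \<bar>b\<bar> + 1"
  have c: "0 < c" "b - c < 0" by (auto simp: c_def)
  have "0 \<le> (a * (- a / c) + b * (- a / c)^2) * c^2"
    using assms[of "- a / c"] by simp
  also have "\<dots> = a^2 * (b - c)"
    using c by (simp add: field_simps power2_eq_square)
  finally have "a^2 \<le> 0"
    using c by (simp add: zero_le_mult_iff)
  then show ?thesis by simp
qed

lemma symmetric_matrix_inner:
  fixes A :: "real^'n^'n"
  assumes "transpose A = A"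
  shows "(A *v x) \<bullet> y = x \<bullet> (A *v y)"
  by (metis assms dot_lmul_matrix vector_transpose_matrix)

text \<open>Perturbing \<open>u\<close> along \<open>w = A u - l u\<close> changes the nonnegative form
  \<open>y \<bullet> A y - l (y \<bullet> y)\<close> by \<open>2t (w \<bullet> w) + O(t\<^sup>2)\<close>, which forces \<open>w = 0\<close>.\<close>
lemma eigenvector_if_minimises_quadratic_form:
  fixes A :: "real^'n^'n"
  assumes sym: "transpose A = A" and S: "subspace S" and inv: "\<And>x. x \<in> S \<Longrightarrow> A *v x \<in> S"
    and "u \<in> S" and "norm u = 1" and min: "\<And>y. y \<in> S \<Longrightarrow> l * (y \<bullet> y) \<le> y \<bullet> (A *v y)"
    and l: "l = u \<bullet> (A *v u)"
  shows "A *v u = l *\<^sub>R u"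
proof -
  define g where "g y = y \<bullet> (A *v y) - l * (y \<bullet> y)" for y
  define w where "w = A *v u - l *\<^sub>R u"
  have "w \<in> S" unfolding w_def using inv \<open>u \<in> S\<close> S by (simp add: subspace_diff subspace_scale)
  have g_line: "g (u + t *\<^sub>R w) = 2 * (w \<bullet> w) * t + g w * t^2" for t
  proof -
    have "u \<bullet> u = 1" using \<open>norm u = 1\<close> by (simp add: norm_eq_1)
    moreover have "u \<bullet> (A *v w) = (A *v u) \<bullet> w" using symmetric_matrix_inner[OF sym] by simp
    ultimately show ?thesis
      by (simp add: g_def w_def l algebra_simps inner_add_left inner_add_right inner_diff_left
          inner_diff_right inner_commute matrix_vector_right_distrib matrix_vector_mult_scaleR
          matrix_vector_mult_diff_distrib power2_eq_square)
  qed
  have "0 \<le> g (u + t *\<^sub>R w)" for t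
    using min \<open>w \<in> S\<close> \<open>u \<in> S\<close> S by (simp add: g_def subspace_add subspace_scale)
  then have "0 \<le> 2 * (w \<bullet> w) * t + g w * t^2" for t
    by (simp only: g_line)
  then have "2 * (w \<bullet> w) = 0"
    by (rule linear_coeff_eq_0_if_quadratic_nonneg)
  then show ?thesis by (simp add: w_def)
qed

lemma symmetric_matrix_has_eigenvector:
  fixes A :: "real^'n^'n"
  assumes sym: "transpose A = A" and S: "subspace S" "S \<noteq> {0}"
    and inv: "\<And>x. x \<in> S \<Longrightarrow> A *v x \<in> S"
  obtains u l where "u \<in> S" "norm u = 1" "A *v u = l *\<^sub>R u"
proof -
  define K where "K = S \<inter> sphere 0 1"
  define f where "f x = x \<bullet> (A *v x)" for x :: "real^'n"
  have "compact K"
    unfolding K_def by (simp add: closed_Int_compact closed_subspace S)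
  moreover obtain x where "x \<in> S" "x \<noteq> 0" using S subspace_0 by blast
  then have "(1 / norm x) *\<^sub>R x \<in> K" unfolding K_def using S by (simp add: subspace_scale)
  then have "K \<noteq> {}" by blast
  moreover have "continuous_on K f"
    unfolding f_def by (intro continuous_intros linear_continuous_on) simp
  ultimately obtain u where u: "u \<in> K" and umin: "\<And>y. y \<in> K \<Longrightarrow> f u \<le> f y"
    using continuous_attains_inf by metis
  have "f u * (y \<bullet> y) \<le> f y" if "y \<in> S" for y
  proof (cases "y = 0")
    case False
    have "(1 / norm y) *\<^sub>R y \<in> K" unfolding K_def using that False S by (simp add: subspace_scale)
    then have "f u \<le> f ((1 / norm y) *\<^sub>R y)" using umin by simp
    also have "\<dots> = f y / (norm y)^2"
      by (simp add: f_def matrix_vector_mult_scaleR power2_eq_square)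
    finally show ?thesis using False by (simp add: field_simps power2_norm_eq_inner)
  qed (simp add: f_def)
  moreover have "u \<in> S" "norm u = 1" using u by (auto simp: K_def)
  ultimately show ?thesis
    using eigenvector_if_minimises_quadratic_form[OF sym S(1) inv] that unfolding f_def by blast
qed

definition orthonormal_eigenbasis :: "real^'n^'n \<Rightarrow> (real^'n) set \<Rightarrow> (real^'n) set \<Rightarrow> bool" where
  "orthonormal_eigenbasis A S B \<longleftrightarrow> finite B \<and> B \<subseteq> S \<and> pairwise orthogonal B
     \<and> (\<forall>b\<in>B. norm b = 1 \<and> (\<exists>l. A *v b = l *\<^sub>R b))
     \<and> (\<forall>x\<in>S. x = (\<Sum>b\<in>B. (b \<bullet> x) *\<^sub>R b))"

lemma orthonormal_eigenbasis_insert: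
  fixes A :: "real^'n^'n"
  assumes S: "subspace S" and "u \<in> S" and "norm u = 1" and "A *v u = l *\<^sub>R u"
    and B: "orthonormal_eigenbasis A (S \<inter> {y. orthogonal u y}) B"
  shows "orthonormal_eigenbasis A S (insert u B)"
proof -
  have uu: "u \<bullet> u = 1" using \<open>norm u = 1\<close> by (simp add: norm_eq_1)
  have orth: "u \<bullet> b = 0" if "b \<in> B" for b
    using B that by (auto simp: orthonormal_eigenbasis_def orthogonal_def)
  then have "u \<notin> B" using uu by force
  have "x = (\<Sum>b\<in>insert u B. (b \<bullet> x) *\<^sub>R b)" if "x \<in> S" for x
  proof -
    define x' where "x' = x - (u \<bullet> x) *\<^sub>R u"
    have "x' \<in> S \<inter> {y. orthogonal u y}"
      unfolding x'_def orthogonal_def using that \<open>u \<in> S\<close> S uu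
      by (simp add: subspace_diff subspace_scale inner_diff_right)
    then have "x' = (\<Sum>b\<in>B. (b \<bullet> x') *\<^sub>R b)" using B by (simp add: orthonormal_eigenbasis_def)
    also have "\<dots> = (\<Sum>b\<in>B. (b \<bullet> x) *\<^sub>R b)"
      using orth by (intro sum.cong) (simp_all add: x'_def inner_diff_right inner_commute)
    finally show ?thesis
      using B \<open>u \<notin> B\<close> by (simp add: x'_def orthonormal_eigenbasis_def algebra_simps)
  qed
  then show ?thesis
    using B orth assms(2-4)
    by (auto simp: orthonormal_eigenbasis_def pairwise_insert orthogonal_def inner_commute)
qed

lemma orthonormal_eigenbasis_exists:
  fixes A :: "real^'n^'n"
  assumes sym: "transpose A = A" and S: "subspace S" and inv: "\<And>x. x \<in> S \<Longrightarrow> A *v x \<in> S"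
  shows "\<exists>B. orthonormal_eigenbasis A S B"
  using S inv
proof (induction "dim S" arbitrary: S rule: less_induct)
  case less
  show ?case
  proof (cases "S = {0}")
    case True
    then show ?thesis by (intro exI[of _ "{}"]) (simp add: orthonormal_eigenbasis_def)
  next
    case False
    obtain u l where uS: "u \<in> S" and nu: "norm u = 1" and ul: "A *v u = l *\<^sub>R u"
      using symmetric_matrix_has_eigenvector[OF sym less.prems(1) False less.prems(2)] by blast
    define S' where "S' = S \<inter> {y. orthogonal u y}"
    have "subspace S'"
      unfolding S'_def by (intro subspace_inter less.prems subspace_orthogonal_to_vector)
    moreover have "A *v x \<in> S'" if "x \<in> S'" for x
    proof -
      have "u \<bullet> (A *v x) = l * (u \<bullet> x)" using symmetric_matrix_inner[OF sym, of u x] ul by simp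
      then show ?thesis using that less.prems(2) by (simp add: S'_def orthogonal_def)
    qed
    moreover have "dim S' < dim S"
    proof -
      have "u \<notin> S'" using nu by (simp add: S'_def orthogonal_def norm_eq_1)
      then have "S' \<subset> S" using uS by (auto simp: S'_def)
      then show ?thesis
        using dim_psubset \<open>subspace S'\<close> less.prems(1) by (metis span_eq_iff)
    qed
    ultimately obtain B' where "orthonormal_eigenbasis A S' B'" using less.hyps by blast
    then show ?thesis
      unfolding S'_def using orthonormal_eigenbasis_insert[OF less.prems(1) uS nu ul] by blast
  qed
qed

lemma norm_sum_orthonormal_squared:
  fixes B :: "(real^'n) set"
  assumes "finite B" "pairwise orthogonal B" "\<And>b. b \<in> B \<Longrightarrow> norm b = 1"
  shows "(norm (\<Sum>b\<in>B. c b *\<^sub>R b))^2 = (\<Sum>b\<in>B. (c b)^2)"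
proof -
  have "pairwise (\<lambda>i j. orthogonal (c i *\<^sub>R i) (c j *\<^sub>R j)) B"
    using assms(2) unfolding pairwise_def by (auto intro: orthogonal_clauses)
  then show ?thesis
    using norm_sum_Pythagorean[OF assms(1), of "\<lambda>b. c b *\<^sub>R b"] assms(3)
    by (simp add: power_mult_distrib)
qed

lemma norm_matrix_vector_le_if_scales_eigenvectors:
  fixes A P :: "real^'n^'n"
  assumes sym: "transpose A = A" and "0 \<le> K"
    and scales: "\<And>b l. norm b = 1 \<Longrightarrow> A *v b = l *\<^sub>R b \<Longrightarrow> \<exists>c. P *v b = c *\<^sub>R b \<and> \<bar>c\<bar> \<le> K"
  shows "norm (P *v v) \<le> K * norm v"
proof -
  obtain B where B: "orthonormal_eigenbasis A UNIV B"
    using orthonormal_eigenbasis_exists[OF sym subspace_UNIV] by blast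
  then have fB: "finite B" and oB: "pairwise orthogonal B" and nB: "\<And>b. b \<in> B \<Longrightarrow> norm b = 1"
    and expand: "\<And>x. x = (\<Sum>b\<in>B. (b \<bullet> x) *\<^sub>R b)"
    by (auto simp: orthonormal_eigenbasis_def)
  obtain c where c: "\<And>b. b \<in> B \<Longrightarrow> P *v b = c b *\<^sub>R b \<and> \<bar>c b\<bar> \<le> K"
    using B scales unfolding orthonormal_eigenbasis_def by metis
  have "P *v v = (\<Sum>b\<in>B. P *v ((b \<bullet> v) *\<^sub>R b))"
    by (subst expand) (rule linear_sum[OF matrix_vector_mul_linear])
  also have "\<dots> = (\<Sum>b\<in>B. ((b \<bullet> v) * c b) *\<^sub>R b)"
    using c by (intro sum.cong) (auto simp: matrix_vector_mult_scaleR)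
  finally have "(norm (P *v v))^2 = (\<Sum>b\<in>B. ((b \<bullet> v) * c b)^2)"
    by (simp add: norm_sum_orthonormal_squared[OF fB oB nB])
  also have "\<dots> \<le> (\<Sum>b\<in>B. K^2 * (b \<bullet> v)^2)"
  proof (intro sum_mono)
    fix b assume "b \<in> B"
    then have "\<bar>c b\<bar> \<le> \<bar>K\<bar>" using c[of b] \<open>0 \<le> K\<close> by simp
    then have "(c b)^2 \<le> K^2" by (simp add: abs_le_square_iff)
    from mult_left_mono[OF this zero_le_power2[of "b \<bullet> v"]]
    show "((b \<bullet> v) * c b)^2 \<le> K^2 * (b \<bullet> v)^2" by (simp add: power_mult_distrib mult.commute)
  qed
  also have "\<dots> = K^2 * (norm v)^2"
    using norm_sum_orthonormal_squared[OF fB oB nB, of "\<lambda>b. b \<bullet> v"]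
    by (simp add: sum_distrib_left flip: expand)
  finally have "(norm (P *v v))^2 \<le> (K * norm v)^2"
    by (simp add: power_mult_distrib)
  then show ?thesis
    by (rule power2_le_imp_le) (simp add: \<open>0 \<le> K\<close>)
qed

lemma cheb_U_mat_eigenvector:
  fixes M :: "real^'n^'n"
  assumes "M *v b = l *\<^sub>R b"
  shows "cheb_U_mat m M *v b = cheb_U m l *\<^sub>R b"
proof (induction m rule: induct_nat_012)
  case (ge2 m)
  have "cheb_U_mat (Suc (Suc m)) M *v b
      = 2 *\<^sub>R (M *v (cheb_U_mat (Suc m) M *v b)) - cheb_U_mat m M *v b"
    by (simp add: matrix_vector_mult_diff_rdistrib matrix_vector_mul_assoc
        flip: scaleR_matrix_vector_assoc)
  with ge2 assms show ?case by (simp add: matrix_vector_mult_scaleR algebra_simps)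
qed (use assms in \<open>simp_all flip: scaleR_matrix_vector_assoc\<close>)

lemma norm_cheb_U_mat_le:
  fixes M :: "real^'n^'n"
  assumes "transpose M = M" and "1 \<le> w"
    and eigenvalues: "\<And>b l. b \<noteq> 0 \<Longrightarrow> M *v b = l *\<^sub>R b \<Longrightarrow> \<bar>l\<bar> \<le> w"
  shows "norm (cheb_U_mat m M *v v) \<le> cheb_U m w * norm v"
proof (rule norm_matrix_vector_le_if_scales_eigenvectors[OF assms(1)])
  show "0 \<le> cheb_U m w" using cheb_U_nonneg[OF assms(2)] .
  fix b :: "real^'n" and l
  assume "norm b = 1" and "M *v b = l *\<^sub>R b"
  then have "\<bar>l\<bar> \<le> w" using eigenvalues[of b l] by (metis norm_zero zero_neq_one)
  then have "\<bar>cheb_U m l\<bar> \<le> cheb_U m w"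
    using assms(2) by (intro abs_cheb_U_le_cheb_U) auto
  with cheb_U_mat_eigenvector[OF \<open>M *v b = l *\<^sub>R b\<close>]
  show "\<exists>c. cheb_U_mat m M *v b = c *\<^sub>R b \<and> \<bar>c\<bar> \<le> cheb_U m w" by blast
qed

lemma abs_eigenvalue_le_spec_radius:
  fixes A :: "real^'n^'n"
  assumes "b \<noteq> 0" and "A *v b = l *\<^sub>R b"
  shows "\<bar>l\<bar> \<le> spec_radius A"
proof -
  define E where "E = {cmod z | z. \<exists>v :: complex^'n. v \<noteq> 0 \<and> complexify_mat A *v v = z *s v}"
  define v where "v = (\<chi> i. complex_of_real (b $ i))"
  have "v \<noteq> 0" using assms(1) by (auto simp: v_def vec_eq_iff)
  moreover have "complexify_mat A *v v = complex_of_real l *s v"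
    using assms(2)
    by (simp add: vec_eq_iff v_def complexify_mat_def matrix_vector_mult_def
        flip: of_real_mult of_real_sum)
  ultimately have "\<bar>l\<bar> \<in> E" unfolding E_def by force
  moreover have "bdd_above E"
  proof -
    obtain K where K: "\<And>v. norm (complexify_mat A *v v) \<le> norm v * K"
      using bounded_linear.bounded[OF matrix_vector_mul_bounded_linear] by blast
    have "e \<le> K" if e: "e \<in> E" for e
    proof -
      obtain z v where "e = cmod z" "v \<noteq> 0" "complexify_mat A *v v = z *s v"
        using e unfolding E_def by blast
      moreover have "norm (z *s v) = cmod z * norm v"
        by (simp add: norm_vec_def L2_set_right_distrib norm_mult)
      ultimately show ?thesis using K[of v] by simp
    qed
    then show ?thesis by (auto simp: bdd_above_def)
  qed
  ultimately show ?thesis unfolding spec_radius_def E_def[symmetric] by (rule cSup_upper)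
qed

section \<open>RKC coefficients\<close>

lemma sum_cheb_U_Suc_Suc:
  fixes f :: "nat \<Rightarrow> real"
  shows "(\<Sum>j=1..Suc (Suc k). f j * cheb_U (Suc (Suc k) - j) x)
    = 2 * x * (\<Sum>j=1..Suc k. f j * cheb_U (Suc k - j) x) - (\<Sum>j=1..k. f j * cheb_U (k - j) x)
      + f (Suc (Suc k))"
proof -
  have "(\<Sum>j=1..k. f j * cheb_U (Suc (Suc k) - j) x)
      = (\<Sum>j=1..k. 2 * x * (f j * cheb_U (Suc k - j) x) - f j * cheb_U (k - j) x)"
  proof (rule sum.cong)
    fix j assume "j \<in> {1..k}"
    then have "Suc (Suc k) - j = Suc (Suc (k - j))" "Suc k - j = Suc (k - j)" by auto
    then show "f j * cheb_U (Suc (Suc k) - j) x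
        = 2 * x * (f j * cheb_U (Suc k - j) x) - f j * cheb_U (k - j) x"
      by (simp add: algebra_simps)
  qed simp
  then show ?thesis
    by (simp add: sum_subtractf sum_distrib_left Suc_diff_Suc algebra_simps)
qed

lemma rkc_c_eq_sum:
  assumes "\<And>j. rkc_b p s eps j \<noteq> 0"
  shows "rkc_c p s eps k = (\<Sum>j=1..k. (rkc_b p s eps k / rkc_b p s eps j
           * (rkc_mu p s eps j + rkc_gamma p s eps j)) * cheb_U (k - j) (rkc_omega0 s eps))"
proof -
  define b where "b = rkc_b p s eps"
  define e where "e k = (\<Sum>j=1..k. (rkc_mu p s eps j + rkc_gamma p s eps j) / b j
    * cheb_U (k - j) (rkc_omega0 s eps))" for k
  have "rkc_c p s eps k = b k * e k"
  proof (induction k rule: induct_nat_012)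
    case 1
    show ?case using assms[of 1] by (simp add: e_def b_def rkc_gamma_def)
  next
    case (ge2 k)
    have "e (Suc (Suc k)) = 2 * rkc_omega0 s eps * e (Suc k) - e k
        + (rkc_mu p s eps (Suc (Suc k)) + rkc_gamma p s eps (Suc (Suc k))) / b (Suc (Suc k))"
      unfolding e_def by (rule sum_cheb_U_Suc_Suc)
    with ge2 show ?case
      using assms[of k] assms[of "Suc k"] assms[of "Suc (Suc k)"]
      by (simp add: rkc_nu_def rkc_kappa_def b_def field_simps)
  qed (simp add: e_def)
  then show ?thesis
    unfolding e_def b_def by (simp add: sum_distrib_left field_simps)
qed

lemma norm_sum_cheb_U_mat_le:
  fixes M :: "real^'n^'n"
  assumes U: "\<And>m v. norm (cheb_U_mat m M *v v) \<le> cheb_U m w * norm v" and "1 \<le> w"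
  shows "norm (\<Sum>j=1..k. a j *\<^sub>R (cheb_U_mat (k - j) M *v r j))
     \<le> (\<Sum>j=1..k. \<bar>a j\<bar> * cheb_U (k - j) w) * Max ((\<lambda>j. norm (r j)) ` {1..k})"
proof -
  let ?R = "Max ((\<lambda>j. norm (r j)) ` {1..k})"
  have "norm (\<Sum>j=1..k. a j *\<^sub>R (cheb_U_mat (k - j) M *v r j))
      \<le> (\<Sum>j=1..k. \<bar>a j\<bar> * norm (cheb_U_mat (k - j) M *v r j))"
    by (rule norm_sum[THEN order_trans]) simp
  also have "\<dots> \<le> (\<Sum>j=1..k. \<bar>a j\<bar> * (cheb_U (k - j) w * ?R))"
  proof (intro sum_mono mult_left_mono)
    fix j assume "j \<in> {1..k}"
    then have "norm (r j) \<le> ?R" by (intro Max_ge) auto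
    then show "norm (cheb_U_mat (k - j) M *v r j) \<le> cheb_U (k - j) w * ?R"
      using U cheb_U_nonneg[OF \<open>1 \<le> w\<close>] by (meson mult_left_mono order_trans)
  qed simp
  finally show ?thesis by (simp add: sum_distrib_right mult.assoc)
qed

locale rkc_parameters =
  fixes p s :: nat and eps :: real
  assumes p: "p \<in> {1, 2}" and s: "1 \<le> s" and s2: "p = 2 \<Longrightarrow> 2 \<le> s" and eps: "0 \<le> eps"
begin

lemma rkc_omega0_ge_1: "1 \<le> rkc_omega0 s eps"
  using eps by (simp add: rkc_omega0_def)

lemma rkc_beta_1:
  "p = 1 \<Longrightarrow> rkc_beta p s eps = 2 * (real s)^2 - 4/3 * (real s)^4 * (rkc_omega0 s eps - 1)"
  using s by (simp add: rkc_beta_def rkc_omega0_def field_simps power2_eq_square power4_eq_xxxx)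

lemma rkc_beta_2:
  "p \<noteq> 1 \<Longrightarrow> rkc_beta p s eps
     = 2/3 * ((real s)^2 - 1) - 4/45 * (real s)^2 * ((real s)^2 - 1) * (rkc_omega0 s eps - 1)"
  using s by (simp add: rkc_beta_def rkc_omega0_def field_simps)

lemma cheb_T_omega0_ge_1: "1 \<le> cheb_T j (rkc_omega0 s eps)"
  using cheb_T_ge_1[of "rkc_omega0 s eps - 1" j] rkc_omega0_ge_1 by simp

lemma cheb_T'_omega0_pos: "1 \<le> j \<Longrightarrow> 0 < cheb_T' j (rkc_omega0 s eps)"
  using cheb_T'_ge[of "rkc_omega0 s eps - 1" j] rkc_omega0_ge_1
  by (simp add: less_le_trans[of 0 "(real j)^2"])

lemma cheb_T''_omega0_pos: "2 \<le> j \<Longrightarrow> 0 < cheb_T'' j (rkc_omega0 s eps)"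
proof -
  assume "2 \<le> j"
  then have "0 < ((real j)^2 - 1) * (real j)^2 / 3"
    by (simp add: power_le_one_iff less_le_trans[of 1 2 "real j"] one_less_power)
  then show ?thesis
    using cheb_T''_ge[of "rkc_omega0 s eps - 1" j] rkc_omega0_ge_1 by simp
qed

lemma rkc_b_pos: "0 < rkc_b p s eps j"
proof -
  have "0 < cheb_T' (max j 2) (rkc_omega0 s eps)" "0 < cheb_T'' (max j 2) (rkc_omega0 s eps)"
    by (simp_all add: cheb_T'_omega0_pos cheb_T''_omega0_pos)
  then show ?thesis
    using cheb_T_omega0_ge_1[of j] by (simp add: rkc_b_def Let_def)
qed

lemma rkc_omega1_pos: "0 < rkc_omega1 p s eps"
  using p s s2 cheb_T_omega0_ge_1[of s] cheb_T'_omega0_pos[of s] cheb_T''_omega0_pos[of s]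
  by (auto simp: rkc_omega1_def)

text \<open>The stability bound \<open>\<beta>\<close> keeps the spectrum of \<open>\<omega>\<^sub>0 I + \<omega>\<^sub>1 \<Delta>t A\<close> inside
  \<open>[-\<omega>\<^sub>0, \<omega>\<^sub>0]\<close>.\<close>
lemma rkc_omega1_beta_le: "rkc_omega1 p s eps * rkc_beta p s eps \<le> 2 * rkc_omega0 s eps"
proof (cases "p = 1")
  case True
  have "rkc_beta p s eps * cheb_T s (rkc_omega0 s eps)
      \<le> 2 * rkc_omega0 s eps * cheb_T' s (rkc_omega0 s eps)"
    using cheb_T_rkc1_bound[of "rkc_omega0 s eps - 1" s] rkc_omega0_ge_1
    by (simp add: rkc_beta_1[OF True])
  then show ?thesis
    using True cheb_T'_omega0_pos[OF s] by (simp add: rkc_omega1_def field_simps)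
next
  case False
  then have "2 \<le> s" using p s2 by auto
  have "rkc_beta p s eps * cheb_T' s (rkc_omega0 s eps)
      \<le> 2 * rkc_omega0 s eps * cheb_T'' s (rkc_omega0 s eps)"
    using cheb_T_rkc2_bound[of "rkc_omega0 s eps - 1" s] rkc_omega0_ge_1
    by (simp add: rkc_beta_2[OF False])
  then show ?thesis
    using False cheb_T''_omega0_pos[OF \<open>2 \<le> s\<close>] by (simp add: rkc_omega1_def field_simps)
qed

lemma rkc_mu_nonneg: "0 \<le> rkc_mu p s eps j"
  using rkc_b_pos[of j] rkc_b_pos[of "j - 1"] rkc_b_pos[of 1] rkc_omega1_pos
  by (simp add: rkc_mu_def)

lemma rkc_mu_gamma_nonneg: "0 \<le> rkc_mu p s eps j + rkc_gamma p s eps j"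
proof (cases "j \<le> 1")
  case False
  then have "rkc_mu p s eps j + rkc_gamma p s eps j
      = rkc_mu p s eps j * (rkc_b p s eps (j - 1) * cheb_T (j - 1) (rkc_omega0 s eps))"
    by (simp add: rkc_gamma_def rkc_a_def algebra_simps)
  then show ?thesis
    using rkc_mu_nonneg rkc_b_pos[of "j - 1"] cheb_T_omega0_ge_1[of "j - 1"] by simp
qed (simp add: rkc_gamma_def rkc_mu_nonneg)

lemma rkc_gamma_eq_0: "p = 1 \<Longrightarrow> rkc_gamma p s eps j = 0"
  using cheb_T_omega0_ge_1[of "j - 1"] by (simp add: rkc_gamma_def rkc_a_def rkc_b_def)

lemma rkc_M_eigenvalue_bound:
  fixes A :: "real^'n^'n"
  assumes nsd: "\<And>x. x \<bullet> (A *v x) \<le> 0" and "0 < dt" and "dt * spec_radius A \<le> rkc_beta p s eps"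
    and "b \<noteq> 0" and eig: "rkc_M p s eps dt A *v b = l *\<^sub>R b"
  shows "\<bar>l\<bar> \<le> rkc_omega0 s eps"
proof -
  let ?w0 = "rkc_omega0 s eps" and ?w1 = "rkc_omega1 p s eps"
  define ev where "ev = (l - ?w0) / (?w1 * dt)"
  have l: "l = ?w0 + ?w1 * dt * ev"
    using rkc_omega1_pos \<open>0 < dt\<close> by (simp add: ev_def)
  have "?w0 *\<^sub>R b + (?w1 * dt) *\<^sub>R (A *v b) = (?w0 + ?w1 * dt * ev) *\<^sub>R b"
    using eig unfolding l
    by (simp add: rkc_M_def matrix_vector_mult_add_rdistrib flip: scaleR_matrix_vector_assoc)
  then have "(?w1 * dt) *\<^sub>R (A *v b) = (?w1 * dt) *\<^sub>R (ev *\<^sub>R b)"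
    by (simp add: algebra_simps)
  then have Ab: "A *v b = ev *\<^sub>R b"
    using rkc_omega1_pos \<open>0 < dt\<close> by (simp only: scaleR_cancel_left) auto
  have "ev * (b \<bullet> b) \<le> 0" using nsd[of b] by (simp add: Ab)
  moreover have "0 < b \<bullet> b" using \<open>b \<noteq> 0\<close> by simp
  ultimately have "ev \<le> 0" by (metis linorder_not_le mult_pos_pos)
  moreover have "- ev \<le> spec_radius A"
    using abs_eigenvalue_le_spec_radius[OF \<open>b \<noteq> 0\<close> Ab] by simp
  then have "?w1 * dt * (- ev) \<le> ?w1 * rkc_beta p s eps"
    using rkc_omega1_pos \<open>0 < dt\<close> assms(3)
    by (metis mult.assoc mult_left_mono order_trans less_imp_le)
  ultimately show ?thesis
    using rkc_omega1_beta_le rkc_omega1_pos \<open>0 < dt\<close> unfolding l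
    by (auto simp: abs_le_iff mult_nonneg_nonpos)
qed

lemma norm_cheb_U_mat_rkc_M_le:
  fixes A :: "real^'n^'n"
  assumes "transpose A = A" and "\<And>x. x \<bullet> (A *v x) \<le> 0" and "0 < dt"
    and "dt * spec_radius A \<le> rkc_beta p s eps"
  shows "norm (cheb_U_mat m (rkc_M p s eps dt A) *v v) \<le> cheb_U m (rkc_omega0 s eps) * norm v"
proof (rule norm_cheb_U_mat_le[OF _ rkc_omega0_ge_1])
  show "transpose (rkc_M p s eps dt A) = rkc_M p s eps dt A"
    using assms(1) by (simp add: rkc_M_def vec_eq_iff transpose_def mat_def)
qed (use rkc_M_eigenvalue_bound assms in blast)

lemma norm_rkc_d_le:
  fixes A :: "real^'n^'n"
  assumes "transpose A = A" and "\<And>x. x \<bullet> (A *v x) \<le> 0" and "0 < dt"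
    and "dt * spec_radius A \<le> rkc_beta p s eps"
  shows "norm (rkc_d p s eps dt A r k) \<le> rkc_c p s eps k * Max ((\<lambda>j. norm (r j)) ` {1..k})"
proof -
  have "norm (rkc_d p s eps dt A r k) \<le> (\<Sum>j=1..k. \<bar>rkc_b p s eps k / rkc_b p s eps j
      * (rkc_mu p s eps j + rkc_gamma p s eps j)\<bar> * cheb_U (k - j) (rkc_omega0 s eps))
      * Max ((\<lambda>j. norm (r j)) ` {1..k})"
    unfolding rkc_d_def
    by (rule norm_sum_cheb_U_mat_le[OF norm_cheb_U_mat_rkc_M_le[OF assms] rkc_omega0_ge_1])
  also have "\<dots> = rkc_c p s eps k * Max ((\<lambda>j. norm (r j)) ` {1..k})"
    using rkc_b_pos rkc_mu_gamma_nonneg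
    by (simp add: rkc_c_eq_sum less_imp_le abs_of_nonneg less_imp_neq[symmetric])
  finally show ?thesis .
qed

lemma rkc_dtilde_eq_rkc_d:
  assumes "p = 1"
  shows "rkc_dtilde p s eps dt A r = rkc_d p s eps dt A r"
proof -
  have "rkc_gamma p s eps j = 0" for j using assms by (rule rkc_gamma_eq_0)
  then show ?thesis by (simp add: fun_eq_iff rkc_dtilde_def rkc_d_def)
qed

lemma norm_rkc_dtilde_le:
  fixes A :: "real^'n^'n"
  assumes "transpose A = A" and "\<And>x. x \<bullet> (A *v x) \<le> 0" and "0 < dt"
    and "dt * spec_radius A \<le> rkc_beta p s eps"
  shows "norm (rkc_dtilde p s eps dt A r k) \<le> (\<Sum>j=1..k. rkc_b p s eps k / rkc_b p s eps j
      * rkc_mu p s eps j * cheb_U (k - j) (rkc_omega0 s eps)) * Max ((\<lambda>j. norm (r j)) ` {1..k})"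
proof -
  have "norm (rkc_dtilde p s eps dt A r k) \<le> (\<Sum>j=1..k. \<bar>rkc_b p s eps k / rkc_b p s eps j
      * rkc_mu p s eps j\<bar> * cheb_U (k - j) (rkc_omega0 s eps)) * Max ((\<lambda>j. norm (r j)) ` {1..k})"
    unfolding rkc_dtilde_def
    by (rule norm_sum_cheb_U_mat_le[OF norm_cheb_U_mat_rkc_M_le[OF assms] rkc_omega0_ge_1])
  then show ?thesis
    using rkc_b_pos rkc_mu_nonneg by (simp add: less_imp_le abs_of_nonneg)
qed

end

theorem lemma3p2:
  fixes p s :: nat and eps :: real
  assumes hp: "p \<in> {1, 2}"
    and hs: "s \<ge> 1"
    and hs2: "p = 2 \<longrightarrow> s \<ge> 2"
    and heps: "eps \<ge> 0"
  shows "(\<forall>k \<in> {1..s}. \<forall>(A :: real^'n^'n) (dt :: real) (r :: nat \<Rightarrow> real^'n).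
           transpose A = A \<and> (\<forall>x. x \<bullet> (A *v x) \<le> 0) \<and> dt > 0
           \<and> dt * spec_radius A \<le> rkc_beta p s eps
           \<longrightarrow> norm (rkc_d p s eps dt A r k)
                 \<le> rkc_c p s eps k * Max ((\<lambda>j. norm (r j)) ` {1..k}))
    \<and> (p = 1 \<longrightarrow> (\<forall>k \<in> {1..s}. \<forall>(A :: real^'n^'n) (dt :: real) (r :: nat \<Rightarrow> real^'n).
           transpose A = A \<and> (\<forall>x. x \<bullet> (A *v x) \<le> 0) \<and> dt > 0
           \<and> dt * spec_radius A \<le> rkc_beta p s eps
           \<longrightarrow> norm (rkc_dtilde p s eps dt A r k)
                 \<le> rkc_c p s eps k * Max ((\<lambda>j. norm (r j)) ` {1..k})))
    \<and> (p = 2 \<longrightarrow> (\<forall>k \<in> {1..s}. \<exists>C :: real. \<forall>(A :: real^'n^'n) (dt :: real) (r :: nat \<Rightarrow> real^'n).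
           transpose A = A \<and> (\<forall>x. x \<bullet> (A *v x) \<le> 0) \<and> dt > 0
           \<and> dt * spec_radius A \<le> rkc_beta p s eps
           \<longrightarrow> norm (rkc_dtilde p s eps dt A r k)
                 \<le> C * Max ((\<lambda>j. norm (r j)) ` {1..k})))"
proof -
  interpret rkc_parameters p s eps
    using assms by unfold_locales auto
  show ?thesis
  proof (intro conjI impI ballI allI)
    fix k and A :: "real^'n^'n" and dt and r :: "nat \<Rightarrow> real^'n"
    assume "transpose A = A \<and> (\<forall>x. x \<bullet> (A *v x) \<le> 0) \<and> dt > 0
      \<and> dt * spec_radius A \<le> rkc_beta p s eps"
    then have d: "norm (rkc_d p s eps dt A r k) \<le> rkc_c p s eps k * Max ((\<lambda>j. norm (r j)) ` {1..k})"
      using norm_rkc_d_le by auto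
    then show "norm (rkc_d p s eps dt A r k) \<le> rkc_c p s eps k * Max ((\<lambda>j. norm (r j)) ` {1..k})" .
    show "norm (rkc_dtilde p s eps dt A r k) \<le> rkc_c p s eps k * Max ((\<lambda>j. norm (r j)) ` {1..k})"
      if "p = 1" using d by (simp only: rkc_dtilde_eq_rkc_d[OF that])
  next
    fix k
    show "\<exists>C. \<forall>(A :: real^'n^'n) dt r. transpose A = A \<and> (\<forall>x. x \<bullet> (A *v x) \<le> 0) \<and> dt > 0
        \<and> dt * spec_radius A \<le> rkc_beta p s eps
        \<longrightarrow> norm (rkc_dtilde p s eps dt A r k) \<le> C * Max ((\<lambda>j. norm (r j)) ` {1..k})"
      using norm_rkc_dtilde_le by blast
  qed
qed

end
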